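(* If $f\in\mathcal{S}^*_{Cr}$, then $f\in\Omega$ in the disc $|z|<r_0$, i.e. $|zf'(z)-f(z)|<\frac12$ for all $|z|<r_0$, where $r_0\approx0.485894$ is the smallest positive root of $2(r+\sqrt{1+r^2}-1)f_0(r)-1=0$ and $$f_0(z)=z\exp\left(\int_0^z\frac{t+\sqrt{1+t^2}-1}{t}\,dt\right)=z+z^2+\frac{3z^3}{4}+\frac{5z^4}{12}+\frac{z^5}{6}+\cdots.$$ This result is sharp, i.e. $r_0$ cannot be replaced by a larger number.
   Context: $\mathbb{D}=\{z\in\mathbb{C}:|z|<1\}$. $\mathcal{A}$ is the class of analytic functions $f$ on $\mathbb{D}$ with $f(0)=0$, $f'(0)=1$. $\Omega=\{f\in\mathcal{A}:|zf'(z)-f(z)|<\frac12,\ z\in\mathbb{D}\}$; "$f\in\Omega$ in the disc $|z|<r_0$" means that the defining inequality holds for all $|z|<r_0$. $\mathcal{S}^*_{Cr}$ is the class of $f\in\mathcal{A}$ with $zf'(z)/f(z)\prec z+\sqrt{1+z^2}$ (principal branch), where $p\prec\phi$ means $p=\phi\circ\omega$ for some analytic $\omega:\mathbb{D}\to\mathbb{D}$ with $\omega(0)=0$. *)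

theory Defs
  imports "HOL-Complex_Analysis.Complex_Analysis"
begin

text \<open>
  Functions on the open unit disc are total functions on \<open>complex\<close>; only their values on
  \<open>ball 0 1\<close> matter.
\<close>

definition class_A :: "(complex \<Rightarrow> complex) set" where
  "class_A = {f. f holomorphic_on ball 0 1 \<and> f 0 = 0 \<and> deriv f 0 = 1}"

text \<open>
  The functions of class \<open>class_A\<close> that satisfy the inequality defining \<open>\<Omega>\<close> in the disc
  \<open>|z| < r\<close>. The points are restricted to the unit disc, where the functions live, so that the
  notion is meaningful for every \<open>r\<close>; the class \<open>\<Omega>\<close> itself is \<open>Omega_in_disc 1\<close>.
\<close>

definition Omega_in_disc :: "real \<Rightarrow> (complex \<Rightarrow> complex) set" where
  "Omega_in_disc r =
     {f \<in> class_A. \<forall>z \<in> ball 0 1. norm z < r \<longrightarrow> norm (z * deriv f z - f z) < 1 / 2}"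

definition subordinate :: "(complex \<Rightarrow> complex) \<Rightarrow> (complex \<Rightarrow> complex) \<Rightarrow> bool" where
  "subordinate p \<phi> \<longleftrightarrow>
     (\<exists>\<omega>. \<omega> holomorphic_on ball 0 1 \<and> \<omega> ` ball 0 1 \<subseteq> ball 0 1 \<and> \<omega> 0 = 0 \<and>
          (\<forall>z \<in> ball 0 1. p z = \<phi> (\<omega> z)))"

definition crescent :: "complex \<Rightarrow> complex" where
  "crescent z = z + csqrt (1 + z\<^sup>2)"

text \<open>
  The quotient \<open>z f'(z) / f(z)\<close> has a removable singularity with value \<open>1\<close> at the origin. At a
  zero of \<open>f\<close> other than the origin the quotient below is \<open>0\<close> by the convention on division;
  since \<open>crescent\<close> has no zeros, no such \<open>f\<close> belongs to the class.
\<close>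

definition class_S_Cr :: "(complex \<Rightarrow> complex) set" where
  "class_S_Cr =
     {f \<in> class_A. subordinate (\<lambda>z. if z = 0 then 1 else z * deriv f z / f z) crescent}"

text \<open>The value of the integrand at the single point \<open>t = 0\<close> does not affect the integral.\<close>

definition f0 :: "complex \<Rightarrow> complex" where
  "f0 z = z * exp (contour_integral (linepath 0 z) (\<lambda>t. (t + csqrt (1 + t\<^sup>2) - 1) / t))"

definition radius_equation :: "real \<Rightarrow> bool" where
  "radius_equation r \<longleftrightarrow>
     2 * of_real (r + sqrt (1 + r\<^sup>2) - 1) * f0 (of_real r) - 1 = 0"

end

theory Submission
  imports Defs
begin

text \<open>
  Integrating \<open>(crescent t - 1) / t\<close> in closed form gives \<open>f0 z = z exp (P z)\<close> with
  \<open>P z = z + s - 1 - Ln ((1 + s) / 2)\<close>, \<open>s = csqrt (1 + z\<^sup>2)\<close>; hence \<open>f0\<close> lies in the class, and its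
  Taylor coefficients follow from \<open>z f0' = (z + s) f0\<close>. For \<open>|w| \<le> r \<le> 3/5\<close> the modulus of
  \<open>crescent w - 1\<close> is largest at \<open>w = r\<close>. By the Schwarz lemma, integrating the logarithmic
  derivative of \<open>f(z) / z\<close> along a ray gives \<open>|f z| \<le> f0 |z|\<close>, and multiplying the two bounds gives
  \<open>|z f' - f| \<le> (r + sqrt (1 + r\<^sup>2) - 1) f0 r\<close> for \<open>r = |z|\<close>. The right-hand side is strictly
  increasing, and equality holds for \<open>f = f0\<close> on the positive real axis.
\<close>

section \<open>The square root and the crescent function on the unit disc\<close>

text \<open>The principal root has nonnegative real part, and a purely imaginary root would have a
  square with real part at most 0, whereas \<open>Re (1 + z\<^sup>2) > 0\<close> in the
  disc.\<close>

lemma Re_csqrt_one_plus_square_pos: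
  assumes "norm z < 1"
  shows "0 < Re (csqrt (1 + z\<^sup>2))"
proof -
  have "\<bar>Re (z\<^sup>2)\<bar> < 1"
    using assms abs_Re_le_cmod[of "z\<^sup>2"] by (simp add: norm_power abs_square_less_1 order_le_less_trans)
  then have "0 < Re (1 + z\<^sup>2)" by simp
  moreover have "Re (1 + z\<^sup>2) = (Re (csqrt (1 + z\<^sup>2)))\<^sup>2 - (Im (csqrt (1 + z\<^sup>2)))\<^sup>2"
    by (metis Re_power2 power2_csqrt)
  ultimately have "Re (csqrt (1 + z\<^sup>2)) \<noteq> 0"
    by (smt (verit) power_zero_numeral zero_le_power2)
  moreover have "0 \<le> Re (csqrt (1 + z\<^sup>2))"
    using csqrt_principal by (metis less_eq_real_def)
  ultimately show ?thesis by simp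
qed

lemma one_plus_square_not_nonpos_Reals:
  fixes z :: complex
  assumes "norm z < 1"
  shows "1 + z\<^sup>2 \<notin> \<real>\<^sub>\<le>\<^sub>0"
proof -
  have "\<bar>Re (z\<^sup>2)\<bar> < 1"
    using assms abs_Re_le_cmod[of "z\<^sup>2"] by (simp add: norm_power abs_square_less_1 order_le_less_trans)
  then show ?thesis by (auto simp: complex_nonpos_Reals_iff)
qed

text \<open>The crescent value is a root of \<open>X\<^sup>2 - 2 * z * X - 1\<close>. This replaces
  the square root by algebra: it rules out zeros and recovers \<open>z\<close> rationally from
  \<open>crescent z\<close>.\<close>

lemma crescent_quadratic: "(crescent z)\<^sup>2 = 2 * z * crescent z + 1"
proof -
  have "(csqrt (1 + z\<^sup>2))\<^sup>2 = 1 + z\<^sup>2" by simp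
  then show ?thesis by (simp only: crescent_def) algebra
qed

lemma crescent_nonzero: "crescent z \<noteq> 0"
  using crescent_quadratic[of z] by auto

section \<open>Sharp modulus bound for \<open>crescent w - 1\<close>\<close>

text \<open>On the circle of radius \<rho> the minimum is at \<open>q = \<rho>\<close>: after
  clearing denominators the difference of the two sides is
  \<open>(\<rho> - Re q) * (1 - \<rho>)\<close>.\<close>

lemma Re_inverse_disc_ge:
  assumes "norm q < 1"
  shows "1 / (1 + norm q) \<le> Re (1 / (1 + q))"
proof -
  define \<rho> where "\<rho> = norm q"
  define N where "N = (1 + Re q)\<^sup>2 + (Im q)\<^sup>2"
  have \<rho>: "0 \<le> \<rho>" "\<rho> < 1" "\<rho>\<^sup>2 = (Re q)\<^sup>2 + (Im q)\<^sup>2"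
    using assms by (auto simp: \<rho>_def cmod_power2)
  have N: "N = 1 + 2 * Re q + \<rho>\<^sup>2" unfolding N_def \<rho>(3) by (simp add: power2_eq_square algebra_simps)
  have Re: "\<bar>Re q\<bar> \<le> \<rho>" by (simp add: \<rho>_def abs_Re_le_cmod)
  have "0 < (1 + Re q)\<^sup>2" using Re \<rho> by (intro zero_less_power) linarith
  then have Npos: "0 < N" by (simp add: N_def add_pos_nonneg)
  have "0 \<le> (\<rho> - Re q) * (1 - \<rho>)" using Re \<rho> by (intro mult_nonneg_nonneg) auto
  then have "N \<le> (1 + Re q) * (1 + \<rho>)"
    by (simp add: N power2_eq_square algebra_simps)
  then have "1 / (1 + \<rho>) \<le> (1 + Re q) / N"
    using Npos \<rho> by (simp add: divide_simps)
  also have "\<dots> = Re (1 / (1 + q))" by (simp add: Re_divide N_def)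
  finally show ?thesis by (simp add: \<rho>_def)
qed

text \<open>
  With \<open>q = crescent w - 1\<close> one has \<open>2 w = q (1 + 1 / (1 + q))\<close>, so a lower bound on
  \<open>Re (1 / (1 + q))\<close> bounds \<open>|w|\<close> from below in terms of \<open>|q|\<close>. Some upper bound on \<open>r\<close> is needed
  to ensure \<open>|q| < 1\<close>.
\<close>

lemma norm_crescent_minus_one_le:
  assumes "norm w \<le> r" "r \<le> 3 / 5"
  shows "norm (crescent w - 1) \<le> r + sqrt (1 + r\<^sup>2) - 1"
proof -
  define s where "s = csqrt (1 + w\<^sup>2)"
  define q where "q = crescent w - 1"
  have r: "0 \<le> r" using assms(1) norm_ge_zero order_trans by blast
  have "0 < Re s" using Re_csqrt_one_plus_square_pos[of w] assms by (simp add: s_def)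
  then have "1 \<le> norm (1 + s)"
    using complex_Re_le_cmod[of "1 + s"] by simp
  moreover have "norm (s - 1) * norm (1 + s) = (norm w)\<^sup>2"
  proof -
    have "s\<^sup>2 = 1 + w\<^sup>2" by (simp add: s_def)
    then have "(s - 1) * (1 + s) = w\<^sup>2" by algebra
    then show ?thesis by (metis norm_mult norm_power)
  qed
  ultimately have "norm (s - 1) \<le> (norm w)\<^sup>2"
    by (metis mult_left_mono mult.right_neutral norm_ge_zero)
  \<comment> \<open>The bound 3/5 enters here: 3/5 + 9/25 = 24/25 < 1, so \<open>|q| < 1\<close>. It
    also leaves room above the critical radius near 0.4859.\<close>
  also have "\<dots> \<le> (3/5)\<^sup>2" using assms by (intro power_mono) auto
  finally have "norm q < 1"
    using norm_triangle_ineq[of w "s - 1"] assms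
    by (simp add: q_def crescent_def s_def power2_eq_square algebra_simps)
  define \<rho> where "\<rho> = norm q"
  have \<rho>: "0 \<le> \<rho>" by (simp add: \<rho>_def)
  have nz: "1 + q \<noteq> 0" using crescent_nonzero[of w] by (simp add: q_def)
  have "(1 + q)\<^sup>2 = 2 * w * (1 + q) + 1" using crescent_quadratic[of w] by (simp add: q_def)
  then have "2 * w * (1 + q) = q * (2 + q)" by algebra
  then have "2 * w = q * (1 + 1 / (1 + q))"
    using nz by (simp add: field_simps)
  then have "2 * norm w = \<rho> * norm (1 + 1 / (1 + q))"
    unfolding \<rho>_def by (metis norm_mult norm_numeral)
  moreover have "1 + 1 / (1 + \<rho>) \<le> norm (1 + 1 / (1 + q))"
    using Re_inverse_disc_ge[OF \<open>norm q < 1\<close>] complex_Re_le_cmod[of "1 + 1 / (1 + q)"]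
    by (simp add: \<rho>_def)
  ultimately have "\<rho> * (1 + 1 / (1 + \<rho>)) \<le> 2 * r"
    using assms \<rho> by (smt (verit) mult_left_mono)
  then have "\<rho> * (2 + \<rho>) \<le> 2 * r * (1 + \<rho>)"
    using \<rho> by (simp add: field_simps)
  \<comment> \<open>Completing the square; the equality case is exactly
    \<open>\<rho> = crescent r - 1\<close>, so the bound is sharp.\<close>
  then have "(\<rho> + 1 - r)\<^sup>2 \<le> 1 + r\<^sup>2"
    by (simp add: power2_eq_square algebra_simps)
  then have "\<rho> + 1 - r \<le> sqrt (1 + r\<^sup>2)" by (rule real_le_rsqrt)
  then show ?thesis by (simp add: \<rho>_def q_def)
qed

section \<open>Closed form of the primitive, and \<open>f0\<close> as a member of the class\<close>

text \<open>The terms \<open>- 1\<close> and \<open>/ 2\<close> normalise the value at the origin to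
  0. In the unit disc the argument of \<open>Ln\<close> has positive real part, so no branch cut is
  met.\<close>

definition crescent_primitive :: "complex \<Rightarrow> complex" where
  "crescent_primitive z =
     z + csqrt (1 + z\<^sup>2) - 1 - Ln ((1 + csqrt (1 + z\<^sup>2)) / 2)"

definition crescent_primitive_real :: "real \<Rightarrow> real" where
  "crescent_primitive_real r = r + sqrt (1 + r\<^sup>2) - 1 - ln ((1 + sqrt (1 + r\<^sup>2)) / 2)"

lemma crescent_primitive_of_real:
  "crescent_primitive (of_real r) = of_real (crescent_primitive_real r)"
proof -
  define s where "s = sqrt (1 + r\<^sup>2)"
  have s: "csqrt (1 + (of_real r)\<^sup>2) = of_real s"
    using csqrt_of_real_nonneg[of "1 + r\<^sup>2"] by (simp add: s_def)
  have "0 \<le> s" by (simp add: s_def)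
  then have "Ln (of_real ((1 + s) / 2)) = of_real (ln ((1 + s) / 2))"
    by (intro Ln_of_real) simp
  then show ?thesis
    unfolding crescent_primitive_def crescent_primitive_real_def s s_def[symmetric] by simp
qed

text \<open>The logarithmic term turns \<open>z / s\<close> into
  \<open>z / s - z / (s * (1 + s)) = z / (1 + s)\<close>. Off the origin this derivative equals
  \<open>(z + s - 1) / z\<close>, because \<open>(s - 1) * (1 + s) = z\<^sup>2\<close>, but it has
  no singularity at 0.\<close>

lemma crescent_primitive_deriv:
  assumes "norm z < 1"
  shows "(crescent_primitive has_field_derivative 1 + z / (1 + csqrt (1 + z\<^sup>2))) (at z)"
proof -
  define s where "s = csqrt (1 + z\<^sup>2)"
  have Re: "0 < Re s" using Re_csqrt_one_plus_square_pos[OF assms] by (simp add: s_def)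
  have s0: "s \<noteq> 0" and s1: "1 + s \<noteq> 0" using Re by (auto simp: complex_eq_iff)
  have n: "(1 + s) / 2 \<notin> \<real>\<^sub>\<le>\<^sub>0"
    using Re by (auto simp: complex_nonpos_Reals_iff)
  have "(crescent_primitive has_field_derivative
      1 + (2 * z) / (2 * s) - ((2 * z) / (2 * s) / 2) / ((1 + s) / 2)) (at z)"
    unfolding crescent_primitive_def s_def
    using one_plus_square_not_nonpos_Reals[OF assms] n[unfolded s_def]
    by (auto intro!: derivative_eq_intros)
  also have "1 + (2 * z) / (2 * s) - ((2 * z) / (2 * s) / 2) / ((1 + s) / 2) = 1 + z / (1 + s)"
    using s0 s1 by (simp add: divide_simps) (simp add: algebra_simps)
  finally show ?thesis by (simp add: s_def)
qed

lemma crescent_primitive_real_deriv: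
  "(crescent_primitive_real has_real_derivative 1 + r / (1 + sqrt (1 + r\<^sup>2))) (at r)"
proof -
  define s where "s = sqrt (1 + r\<^sup>2)"
  have r: "0 < 1 + r\<^sup>2" by (simp add: add_pos_nonneg)
  then have s: "0 < s" by (simp add: s_def)
  then have s1: "0 < (1 + s) / 2" by simp
  have "(crescent_primitive_real has_real_derivative
      1 + (2 * r) / (2 * s) - ((2 * r) / (2 * s) / 2) / ((1 + s) / 2)) (at r)"
    unfolding crescent_primitive_real_def s_def
    using r s1[unfolded s_def]
    by (auto intro!: derivative_eq_intros simp: inverse_eq_divide)
  also have "1 + (2 * r) / (2 * s) - ((2 * r) / (2 * s) / 2) / ((1 + s) / 2) = 1 + r / (1 + s)"
    using s by (simp add: divide_simps) (simp add: algebra_simps)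
  finally show ?thesis by (simp add: s_def)
qed

lemma crescent_primitive_0 [simp]: "crescent_primitive 0 = 0"
  by (simp add: crescent_primitive_def)

lemma crescent_primitive_real_0 [simp]: "crescent_primitive_real 0 = 0"
  by (simp add: crescent_primitive_real_def)

lemma f0_eq_exp_crescent_primitive:
  assumes "norm z < 1"
  shows "f0 z = z * exp (crescent_primitive z)"
proof (cases "z = 0")
  case False
  have path: "path_image (linepath 0 z) \<subseteq> ball 0 1"
    using assms by (simp add: closed_segment_subset)
  have "((\<lambda>t. 1 + t / (1 + csqrt (1 + t\<^sup>2))) has_contour_integral
      (crescent_primitive (pathfinish (linepath 0 z)) - crescent_primitive (pathstart (linepath 0 z))))
      (linepath 0 z)"
    using path
    by (intro contour_integral_primitive[where S = "ball 0 1"] valid_path_linepath)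
       (auto intro: DERIV_subset crescent_primitive_deriv simp del: linepath_0)
  then have "contour_integral (linepath 0 z) (\<lambda>t. 1 + t / (1 + csqrt (1 + t\<^sup>2)))
      = crescent_primitive z"
    by (simp add: contour_integral_unique)
  \<comment> \<open>The integrands differ only at \<open>t = 0\<close>, where division by zero makes
    the left one 0 and the right one is 1. For \<open>z \<noteq> 0\<close> the segment is a simple
    path, so one point is negligible.\<close>
  moreover have "contour_integral (linepath 0 z) (\<lambda>t. (t + csqrt (1 + t\<^sup>2) - 1) / t)
      = contour_integral (linepath 0 z) (\<lambda>t. 1 + t / (1 + csqrt (1 + t\<^sup>2)))"
  proof (rule contour_integral_spike_finite_simple_path[where A = "{0}"])
    fix t assume "t \<in> path_image (linepath 0 z) - {0}"
    then have t: "norm t < 1" "t \<noteq> 0" using path by auto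
    define s where "s = csqrt (1 + t\<^sup>2)"
    have "0 < Re s" using Re_csqrt_one_plus_square_pos[OF t(1)] by (simp add: s_def)
    then have "1 + s \<noteq> 0" by (auto simp: complex_eq_iff)
    moreover have "s\<^sup>2 = 1 + t\<^sup>2" by (simp add: s_def)
    then have "(s - 1) * (1 + s) = t * t" by algebra
    ultimately have "(s - 1) / t = t / (1 + s)" using t by (simp add: frac_eq_eq)
    then have "(t + s - 1) / t = 1 + t / (1 + s)"
      using t by (simp add: add_divide_distrib diff_divide_distrib)
    then show "(t + csqrt (1 + t\<^sup>2) - 1) / t = 1 + t / (1 + csqrt (1 + t\<^sup>2))"
      by (simp add: s_def)
  qed (use False in auto)
  ultimately show ?thesis by (simp add: f0_def)
qed (simp add: f0_def)

lemma f0_0 [simp]: "f0 0 = 0"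
  by (simp add: f0_def)

text \<open>The product rule leaves the factor \<open>1 + z * (1 + z / (1 + s))\<close>, which is
  \<open>z + s\<close> since \<open>z\<^sup>2 / (1 + s) = s - 1\<close>. Nothing is divided by
  \<open>z\<close>, so the origin is covered.\<close>

lemma f0_deriv:
  assumes "norm z < 1"
  shows "(f0 has_field_derivative crescent z * exp (crescent_primitive z)) (at z)"
proof -
  define s where "s = csqrt (1 + z\<^sup>2)"
  have "0 < Re s" using Re_csqrt_one_plus_square_pos[OF assms] by (simp add: s_def)
  then have "1 + s \<noteq> 0" by (auto simp: complex_eq_iff)
  moreover have "s\<^sup>2 = 1 + z\<^sup>2" by (simp add: s_def)
  then have "(s - 1) * (1 + s) = z * z" by algebra
  ultimately have "z * (z / (1 + s)) = s - 1" by (simp add: field_simps)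
  then have eq: "1 + z * (1 + z / (1 + s)) = crescent z"
    by (simp add: crescent_def s_def algebra_simps)
  have "((\<lambda>z. z * exp (crescent_primitive z)) has_field_derivative
      exp (crescent_primitive z) + z * (exp (crescent_primitive z) * (1 + z / (1 + s)))) (at z)"
    unfolding s_def
    by (auto intro!: derivative_eq_intros crescent_primitive_deriv[OF assms])
  also have "exp (crescent_primitive z) + z * (exp (crescent_primitive z) * (1 + z / (1 + s)))
      = (1 + z * (1 + z / (1 + s))) * exp (crescent_primitive z)"
    by (simp add: algebra_simps)
  finally have "((\<lambda>z. z * exp (crescent_primitive z)) has_field_derivative
      crescent z * exp (crescent_primitive z)) (at z)" by (simp only: eq)
  then show ?thesis
    by (rule has_field_derivative_transform_within_open[where S = "ball 0 1"])
       (use assms in \<open>auto simp: f0_eq_exp_crescent_primitive\<close>)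
qed

lemma f0_holomorphic: "f0 holomorphic_on ball 0 1"
  using f0_deriv by (force simp: holomorphic_on_open)

lemma deriv_f0_mult: "norm z < 1 \<Longrightarrow> z * deriv f0 z = crescent z * f0 z"
  by (simp add: DERIV_imp_deriv[OF f0_deriv] f0_eq_exp_crescent_primitive)

lemma deriv_f0_0: "deriv f0 0 = 1"
  using DERIV_imp_deriv[OF f0_deriv, of 0] by (simp add: crescent_def)

text \<open>For \<open>f0\<close> the quotient is \<open>crescent\<close> itself, so the identity
  serves as \<omega>.\<close>

lemma f0_in_class_S_Cr: "f0 \<in> class_S_Cr"
proof -
  have "(if z = 0 then 1 else z * deriv f0 z / f0 z) = crescent z" if "z \<in> ball 0 1" for z
    using that by (auto simp: deriv_f0_mult f0_eq_exp_crescent_primitive crescent_def)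
  then have "subordinate (\<lambda>z. if z = 0 then 1 else z * deriv f0 z / f0 z) crescent"
    unfolding subordinate_def by (intro exI[of _ "\<lambda>z. z"]) auto
  then show ?thesis
    by (simp add: class_S_Cr_def class_A_def f0_holomorphic deriv_f0_0)
qed

section \<open>Taylor coefficients of \<open>f0\<close>\<close>

lemma f0_power_series:
  "\<exists>c. (\<forall>z \<in> ball 0 1. (\<lambda>n. c n * z ^ n) sums f0 z) \<and>
     c 0 = 0 \<and> c 1 = 1 \<and> c 2 = 1 \<and> c 3 = 3 / 4 \<and> c 4 = 5 / 12 \<and> c 5 = 1 / 6"
proof -
  define F where "F = fps_expansion f0 0"
  define S where "S = fps_expansion (\<lambda>z. csqrt (1 + z\<^sup>2)) 0"
  have F: "f0 has_fps_expansion F"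
    unfolding F_def
    by (rule has_fps_expansion_fps_expansion[of "ball 0 1"]) (auto intro: f0_holomorphic)
  have S: "(\<lambda>z. csqrt (1 + z\<^sup>2)) has_fps_expansion S"
    unfolding S_def
    by (rule has_fps_expansion_fps_expansion[of "ball 0 1"])
       (auto intro!: holomorphic_intros simp: one_plus_square_not_nonpos_Reals)
  have "(\<lambda>z. csqrt (1 + z\<^sup>2) * csqrt (1 + z\<^sup>2)) has_fps_expansion S * S"
    by (intro has_fps_expansion_mult S)
  then have "(\<lambda>z. 1 + z\<^sup>2) has_fps_expansion S * S"
    by (simp flip: power2_eq_square)
  moreover have "(\<lambda>z::complex. 1 + z\<^sup>2) has_fps_expansion 1 + fps_X\<^sup>2"
    by (intro fps_expansion_intros)
  ultimately have SS: "S * S = 1 + fps_X\<^sup>2" by (rule fps_expansion_unique_complex)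
  have "(\<lambda>z. z * deriv f0 z) has_fps_expansion fps_X * fps_deriv F"
    by (intro fps_expansion_intros F)
  moreover have "(\<lambda>z. (z + csqrt (1 + z\<^sup>2)) * f0 z) has_fps_expansion (fps_X + S) * F"
    by (intro fps_expansion_intros F S)
  moreover have "eventually (\<lambda>z. z * deriv f0 z = (z + csqrt (1 + z\<^sup>2)) * f0 z) (nhds 0)"
    using eventually_nhds_in_open[of "ball 0 1" 0]
    by (auto elim!: eventually_mono simp: deriv_f0_mult crescent_def)
  ultimately have ODE: "fps_X * fps_deriv F = (fps_X + S) * F"
    by (simp add: fps_expansion_unique_complex has_fps_expansion_cong[OF _ refl])
  \<comment> \<open>The equation for \<open>S * S\<close> determines \<open>S\<close> up to sign;
    the principal branch fixes the sign.\<close>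
  have S0: "S $ 0 = 1" by (simp add: S_def fps_expansion_def)
  have SSn: "(S * S) $ n = (1 + fps_X\<^sup>2) $ n" for n by (simp add: SS)
  have S1: "S $ Suc 0 = 0" using SSn[of 1] S0 by (simp add: fps_mult_nth)
  have S2: "S $ 2 = 1 / 2" using SSn[of 2] S0 S1
    by (simp add: fps_mult_nth numeral_eq_Suc field_simps)
  have S3: "S $ 3 = 0" using SSn[of 3] S0 S1 S2
    by (simp add: fps_mult_nth numeral_eq_Suc field_simps)
  have "2 * S $ 4 + S $ 2 * S $ 2 = 0" using SSn[of 4] S0 S1 S3
    by (simp add: fps_mult_nth numeral_eq_Suc)
  then have S4: "S $ 4 = - 1 / 8" by (simp add: S2 add_eq_0_iff field_simps)
  have F0: "F $ 0 = 0" by (simp add: F_def fps_expansion_def)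
  have F1: "F $ Suc 0 = 1" by (simp add: F_def fps_expansion_def deriv_f0_0)
  \<comment> \<open>The term \<open>i = 0\<close> is \<open>F $ m\<close> itself, so solving for
    \<open>F $ m\<close> divides by \<open>m - 1\<close>. The term \<open>i = m\<close> vanishes
    because \<open>F $ 0 = 0\<close>, hence \<open>F $ 5\<close> needs \<open>S\<close> only up to
    index 4.\<close>
  have Fn: "of_nat m * F $ m = F $ n + (\<Sum>i=0..m. S $ i * F $ (m - i))"
    if "m = Suc n" for m n
    unfolding that using arg_cong[OF ODE, of "\<lambda>G. G $ Suc n"]
    by (simp only: ring_distribs fps_add_nth fps_X_mult_nth) (simp add: fps_mult_nth)
  have "(\<Sum>i=0..2. g i) = g 0 + g 1 + g 2" for g :: "nat \<Rightarrow> complex"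
    by (simp add: numeral_eq_Suc del: Suc_numeral)
  then have F2: "F $ 2 = 1"
    using Fn[of 2 1] by (simp add: S0 S1 F0 F1 field_simps)
  have "(\<Sum>i=0..3. g i) = g 0 + g 1 + g 2 + g 3" for g :: "nat \<Rightarrow> complex"
    by (simp add: numeral_eq_Suc del: Suc_numeral)
  then have F3: "F $ 3 = 3 / 4"
    using Fn[of 3 2] by (simp add: S0 S1 S2 F0 F1 F2 field_simps)
  have "(\<Sum>i=0..4. g i) = g 0 + g 1 + g 2 + g 3 + g 4" for g :: "nat \<Rightarrow> complex"
    by (simp add: numeral_eq_Suc del: Suc_numeral)
  then have F4: "F $ 4 = 5 / 12"
    using Fn[of 4 3] by (simp add: S0 S1 S2 S3 F0 F1 F2 F3 field_simps)
  have "(\<Sum>i=0..5. g i) = g 0 + g 1 + g 2 + g 3 + g 4 + g 5" for g :: "nat \<Rightarrow> complex"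
    by (simp add: numeral_eq_Suc del: Suc_numeral)
  then have F5: "F $ 5 = 1 / 6"
    using Fn[of 5 4] by (simp add: S0 S1 S2 S3 S4 F0 F1 F2 F3 F4 field_simps)
  have "(\<lambda>n. F $ n * z ^ n) sums f0 z" if "z \<in> ball 0 1" for z
    using has_fps_expansion_imp_sums_complex[OF F, of 1 z] f0_holomorphic that
    by (simp add: one_ereal_def)
  then show ?thesis using F0 F1 F2 F3 F4 F5 by (intro exI[of _ "fps_nth F"]) auto
qed

section \<open>Growth bound for the class\<close>

text \<open>The Schwarz lemma bounds \<omega>. At a zero of \<open>f\<close> off the origin the
  quotient would be 0 by convention, a value \<open>crescent\<close> never takes. The product form
  of the equation also holds at 0.\<close>

lemma class_S_Cr_obtains:
  assumes "f \<in> class_S_Cr"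
  obtains \<omega> where "\<And>z. norm z < 1 \<Longrightarrow> norm (\<omega> z) \<le> norm z"
    and "\<And>z. norm z < 1 \<Longrightarrow> z \<noteq> 0 \<Longrightarrow> f z \<noteq> 0"
    and "\<And>z. norm z < 1 \<Longrightarrow> z * deriv f z = crescent (\<omega> z) * f z"
proof -
  have A: "f 0 = 0" using assms by (simp add: class_S_Cr_def class_A_def)
  obtain \<omega> where \<omega>: "\<omega> holomorphic_on ball 0 1" "\<omega> ` ball 0 1 \<subseteq> ball 0 1" "\<omega> 0 = 0"
    and eq: "\<And>z. z \<in> ball 0 1 \<Longrightarrow> (if z = 0 then 1 else z * deriv f z / f z) = crescent (\<omega> z)"
    using assms by (auto simp: class_S_Cr_def subordinate_def)
  have norm: "norm (\<omega> z) < 1" if "norm z < 1" for z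
    using \<omega>(2) that by (auto simp: image_subset_iff)
  have "norm (\<omega> z) \<le> norm z" if "norm z < 1" for z
    using Schwarz_Lemma(1)[OF \<omega>(1,3) norm that] by simp
  moreover have nz: "f z \<noteq> 0" if "norm z < 1" "z \<noteq> 0" for z
    using eq[of z] that crescent_nonzero[of "\<omega> z"] by auto
  moreover have "z * deriv f z = crescent (\<omega> z) * f z" if "norm z < 1" for z
    using eq[of z] nz[of z] that A by (cases "z = 0") (auto simp: field_simps)
  ultimately show thesis by (rule that)
qed

text \<open>The right-hand side is \<open>f0\<close> at \<open>|z|\<close>. Writing
  \<open>f w = w * exp (L w)\<close> reduces the claim to a bound on \<open>Re (L z)\<close>,
  obtained by comparing derivatives along the ray from 0 to \<open>z\<close>.\<close>

lemma norm_class_S_Cr_le: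
  assumes f: "f \<in> class_S_Cr" and z: "norm z \<le> 3 / 5"
  shows "norm (f z) \<le> norm z * exp (crescent_primitive_real (norm z))"
proof (cases "z = 0")
  case True
  with f show ?thesis by (simp add: class_S_Cr_def class_A_def)
next
  case False
  obtain \<omega> where \<omega>: "\<And>z. norm z < 1 \<Longrightarrow> norm (\<omega> z) \<le> norm z"
    and nz: "\<And>z. norm z < 1 \<Longrightarrow> z \<noteq> 0 \<Longrightarrow> f z \<noteq> 0"
    and eq: "\<And>z. norm z < 1 \<Longrightarrow> z * deriv f z = crescent (\<omega> z) * f z"
    using class_S_Cr_obtains[OF f] by metis
  have holf: "f holomorphic_on ball 0 1" and f0: "f 0 = 0" and f1: "deriv f 0 = 1"
    using f by (auto simp: class_S_Cr_def class_A_def)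
  obtain h where holh: "h holomorphic_on ball 0 1"
    and fh: "\<And>z. norm z < 1 \<Longrightarrow> f z = z * h z" and h0: "deriv f 0 = h 0"
    using Schwarz3[OF holf f0] by metis
  \<comment> \<open>Away from 0 the zeros of \<open>h\<close> are those of \<open>f\<close>, and
    \<open>h 0 = 1\<close>; so \<open>h\<close> has a holomorphic logarithm on the disc.\<close>
  have "h z \<noteq> 0" if "z \<in> ball 0 1" for z
    using nz[of z] fh[of z] h0 f1 that by (cases "z = 0") auto
  then obtain L where holL: "L holomorphic_on ball 0 1"
    and L: "\<And>z. z \<in> ball 0 1 \<Longrightarrow> h z = exp (L z)"
    using contractible_imp_holomorphic_log[OF holh] convex_imp_contractible convex_ball by metis
  have fL: "f w = w * exp (L w)" if "norm w < 1" for w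
    using fh L that by simp
  have L': "(L has_field_derivative deriv L w) (at w)" if "norm w < 1" for w
    using holL that by (intro holomorphic_derivI[of _ "ball 0 1"]) auto
  have dL: "w * deriv L w = crescent (\<omega> w) - 1" if w: "norm w < 1" "w \<noteq> 0" for w
  proof -
    have "((\<lambda>w. w * exp (L w)) has_field_derivative
        exp (L w) + w * (exp (L w) * deriv L w)) (at w)"
      by (auto intro!: derivative_eq_intros L' w)
    then have "(f has_field_derivative exp (L w) + w * (exp (L w) * deriv L w)) (at w)"
      by (rule has_field_derivative_transform_within_open[where S = "ball 0 1"])
         (use w fL in auto)
    then have "deriv f w = exp (L w) * (1 + w * deriv L w)"
      by (simp add: DERIV_imp_deriv algebra_simps)
    then have "(w * exp (L w)) * (1 + w * deriv L w) = (w * exp (L w)) * crescent (\<omega> w)"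
      using eq[OF w(1)] fL[OF w(1)] by (simp add: algebra_simps)
    then have "1 + w * deriv L w = crescent (\<omega> w)" using w by simp
    then show ?thesis by (simp add: algebra_simps)
  qed
  define r where "r = norm z"
  have r: "0 < r" "r \<le> 3 / 5" using z False by (auto simp: r_def)
  define \<phi> where "\<phi> t = crescent_primitive_real (t * r) - Re (L (of_real t * z))" for t
  have small: "norm (of_real t * z) < 1" if "0 \<le> t" "t \<le> 1" for t
  proof -
    have "t * r \<le> 1 * r" using that r by (intro mult_right_mono) auto
    then have "t * r < 1" using r by linarith
    then show ?thesis using that by (simp add: norm_mult r_def)
  qed
  have der: "(\<phi> has_real_derivative
      (1 + t * r / (1 + sqrt (1 + (t * r)\<^sup>2))) * r - Re (deriv L (of_real t * z) * z)) (at t)"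
    if t: "0 \<le> t" "t \<le> 1" for t
  proof -
    have "((\<lambda>t. crescent_primitive_real (t * r)) has_real_derivative
        (1 + t * r / (1 + sqrt (1 + (t * r)\<^sup>2))) * r) (at t)"
      by (rule DERIV_chain2[OF crescent_primitive_real_deriv]) (auto intro!: derivative_eq_intros)
    moreover have "((\<lambda>t. L (t * z)) has_field_derivative deriv L (of_real t * z) * z) (at (of_real t))"
      by (rule DERIV_chain2[where g = "\<lambda>t. t * z", OF L'[OF small[OF t]]]) (auto intro!: derivative_eq_intros)
    then have "((\<lambda>t. L (of_real t * z)) has_vector_derivative deriv L (of_real t * z) * z) (at t)"
      by (rule has_vector_derivative_real_field)
    then have "((\<lambda>t. Re (L (of_real t * z))) has_real_derivative Re (deriv L (of_real t * z) * z)) (at t)"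
      by (intro has_field_derivative_Re)
    ultimately show ?thesis
      unfolding \<phi>_def by (rule DERIV_diff)
  qed
  have "\<phi> 0 \<le> \<phi> 1"
  proof (rule DERIV_nonneg_imp_increasing_open[where f = \<phi>])
    show "continuous_on {0..1} \<phi>"
      using der by (intro DERIV_continuous_on) (auto intro: DERIV_subset)
  next
    fix t :: real assume t: "0 < t" "t < 1"
    define s where "s = sqrt (1 + (t * r)\<^sup>2)"
    define w where "w = of_real t * z"
    have "t * r \<le> r" using t r by (simp add: mult_left_le_one_le)
    then have tr: "0 < t * r" "t * r \<le> 3 / 5"
      using t r order_trans[of "t * r" r "3 / 5"] by simp_all
    have w: "norm w < 1" "w \<noteq> 0" "norm w = t * r"
      using small[of t] t False by (auto simp: w_def norm_mult r_def)
    have s: "0 < s" "s\<^sup>2 = 1 + (t * r)\<^sup>2"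
      by (auto simp: s_def add_pos_nonneg)
    then have "(s - 1) * (1 + s) = t * r * (t * r)" by algebra
    then have "t * r * (t * r / (1 + s)) = s - 1" using s(1) by (simp add: field_simps)
    \<comment> \<open>Multiplying the derivative of \<phi> by \<open>t > 0\<close> turns its two
      terms into \<open>t * r + s - 1\<close> and \<open>Re (w * deriv L w)\<close>, which the
      crescent bound compares.\<close>
    then have "t * ((1 + t * r / (1 + s)) * r) = t * r + s - 1" by (simp add: algebra_simps)
    moreover have "t * Re (deriv L w * z) = Re (w * deriv L w)"
      by (simp add: w_def algebra_simps)
    moreover have "Re (w * deriv L w) \<le> t * r + s - 1"
      unfolding dL[OF w(1,2)] s_def
      using complex_Re_le_cmod norm_crescent_minus_one_le[of "\<omega> w" "t * r"] \<omega>[OF w(1)] w(3) tr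
      by (metis order_trans)
    ultimately have "0 \<le> t * ((1 + t * r / (1 + s)) * r - Re (deriv L w * z))"
      by (simp add: right_diff_distrib)
    then have "0 \<le> (1 + t * r / (1 + s)) * r - Re (deriv L w * z)"
      using t by (simp add: zero_le_mult_iff)
    then show "\<exists>y. (\<phi> has_real_derivative y) (at t) \<and> 0 \<le> y"
      using der[of t] t by (auto simp: s_def w_def)
  qed simp
  \<comment> \<open>\<open>L 0\<close> is known only up to multiples of
    \<open>2 * pi * \<i>\<close>, but \<open>exp (L 0) = 1\<close> settles its real part.\<close>
  moreover have "Re (L 0) = 0"
    using L[of 0] h0 f1 norm_exp_eq_Re[of "L 0"] by simp
  ultimately have "Re (L z) \<le> crescent_primitive_real r"
    by (auto simp: \<phi>_def)
  then show ?thesis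
    using fL[of z] z by (simp add: r_def norm_mult mult_left_mono)
qed

section \<open>Numerical location of the critical radius\<close>

text \<open>For \<open>0 \<le> r < 1\<close> this is the value of
  \<open>z * deriv f0 z - f0 z\<close> at \<open>z = r\<close>, so the radius equation asks for the
  value 1/2.\<close>

definition extremal_defect :: "real \<Rightarrow> real" where
  "extremal_defect r = (r + sqrt (1 + r\<^sup>2) - 1) * (r * exp (crescent_primitive_real r))"

lemma extremal_defect_strict_mono:
  assumes "0 \<le> r" "r < r'"
  shows "extremal_defect r < extremal_defect r'"
proof -
  have "r\<^sup>2 \<le> r'\<^sup>2" using assms by (intro power_mono) auto
  then have e: "r + sqrt (1 + r\<^sup>2) - 1 < r' + sqrt (1 + r'\<^sup>2) - 1"
    using assms by (intro diff_strict_right_mono add_less_le_mono) auto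
  have "1 \<le> sqrt (1 + r\<^sup>2)" by simp
  then have e0: "0 \<le> r + sqrt (1 + r\<^sup>2) - 1" using assms by linarith
  have "crescent_primitive_real r \<le> crescent_primitive_real r'"
  proof (rule DERIV_nonneg_imp_nondecreasing[where f = crescent_primitive_real])
    fix x assume "r \<le> x"
    then have "0 \<le> 1 + x / (1 + sqrt (1 + x\<^sup>2))" using assms by simp
    then show "\<exists>y. (crescent_primitive_real has_real_derivative y) (at x) \<and> 0 \<le> y"
      using crescent_primitive_real_deriv by blast
  qed (use assms in simp)
  then have "r * exp (crescent_primitive_real r) < r' * exp (crescent_primitive_real r')"
    using assms by (intro mult_less_le_imp_less) auto
  then show ?thesis
    unfolding extremal_defect_def using e e0 assms
    by (intro mult_strict_mono[where ?d = "r' * exp (crescent_primitive_real r')"]) simp_all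
qed

text \<open>Cancelling the logarithm leaves only a square root and an exponential to estimate
  numerically.\<close>

lemma extremal_defect_eq:
  "extremal_defect r =
     (r + sqrt (1 + r\<^sup>2) - 1) * r * exp (r + sqrt (1 + r\<^sup>2) - 1) * 2 / (1 + sqrt (1 + r\<^sup>2))"
proof -
  have "0 < 1 + sqrt (1 + r\<^sup>2)" by (simp add: add_pos_nonneg)
  then show ?thesis
    by (simp add: extremal_defect_def crescent_primitive_real_def exp_diff)
qed

lemma f0_of_real:
  "\<bar>r\<bar> < 1 \<Longrightarrow> f0 (of_real r) = of_real (r * exp (crescent_primitive_real r))"
  by (simp add: f0_eq_exp_crescent_primitive crescent_primitive_of_real exp_of_real)

lemma radius_equation_iff:
  assumes "\<bar>r\<bar> < 1"
  shows "radius_equation r \<longleftrightarrow> extremal_defect r = 1 / 2"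
proof -
  have "2 * of_real (r + sqrt (1 + r\<^sup>2) - 1) * f0 (of_real r) - 1
      = of_real (2 * extremal_defect r - 1)"
    by (simp add: f0_of_real[OF assms] extremal_defect_def)
  then have "radius_equation r \<longleftrightarrow> 2 * extremal_defect r - 1 = 0"
    unfolding radius_equation_def by (simp only: of_real_eq_0_iff)
  then show ?thesis by linarith
qed

text \<open>The point is 0.485894 - 0.0000005. Upper bounds go into the numerator and the lower
  bound for \<open>s\<close> into the denominator; the exponential is a Maclaurin sum with remainder
  estimated by \<open>exp t \<le> 3\<close>.\<close>

lemma extremal_defect_lower: "extremal_defect 0.4858935 < 1 / 2"
proof -
  define s where "s = sqrt (1 + 0.4858935\<^sup>2)"
  define y where "y = 0.4858935 + s - 1"
  have s: "1.1117969 \<le> s" "s \<le> 1.111797"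
    unfolding s_def
    by (rule real_le_rsqrt, simp add: power2_eq_square)
       (rule real_le_lsqrt, simp_all add: power2_eq_square)
  have y: "0 \<le> y" "y \<le> 0.5976905" using s by (auto simp: y_def)
  obtain t where t: "\<bar>t\<bar> \<le> \<bar>0.5976905\<bar>" and
    exp: "exp (0.5976905::real) = (\<Sum>m<10. 0.5976905 ^ m / fact m) + exp t / fact 10 * 0.5976905 ^ 10"
    using Maclaurin_exp_le by blast
  have "exp t \<le> exp 1" using t by simp
  also have "\<dots> \<le> 3" by (rule exp_le)
  finally have "exp t / fact 10 * 0.5976905 ^ 10 \<le> 3 / fact 10 * 0.5976905 ^ 10"
    by (intro mult_right_mono divide_right_mono) auto
  with exp have "exp (0.5976905::real) \<le> (\<Sum>m<10. 0.5976905 ^ m / fact m) + 3 / fact 10 * 0.5976905 ^ 10"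
    by linarith
  also have "\<dots> \<le> (1.817916::real)" by (simp add: lessThan_nat_numeral fact_numeral power_divide)
  finally have "exp y \<le> 1.817916" using y(2) by (meson exp_le_cancel_iff order_trans)
  then have "y * 0.4858935 * exp y * 2 / (1 + s)
      \<le> 0.5976905 * 0.4858935 * 1.817916 * 2 / (1 + 1.1117969)"
    using s y by (intro frac_le mult_mono mult_nonneg_nonneg) auto
  also have "\<dots> < 1 / 2" by simp
  finally show ?thesis unfolding extremal_defect_eq s_def[symmetric] y_def[symmetric] .
qed

text \<open>The mirror estimate at 0.485894 + 0.0000005. The Maclaurin remainder is nonnegative, so
  the partial sum alone bounds the exponential from below.\<close>

lemma extremal_defect_upper: "1 / 2 < extremal_defect 0.4858945"
proof -
  define s where "s = sqrt (1 + 0.4858945\<^sup>2)"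
  define y where "y = 0.4858945 + s - 1"
  have s: "1.1117974 \<le> s" "s \<le> 1.1117975"
    unfolding s_def
    by (rule real_le_rsqrt, simp add: power2_eq_square)
       (rule real_le_lsqrt, simp_all add: power2_eq_square)
  have y: "0.5976919 \<le> y" using s by (auto simp: y_def)
  obtain t where
    exp: "exp (0.5976919::real) = (\<Sum>m<10. 0.5976919 ^ m / fact m) + exp t / fact 10 * 0.5976919 ^ 10"
    using Maclaurin_exp_le by blast
  have "(1.817917::real) \<le> (\<Sum>m<10. 0.5976919 ^ m / fact m)"
    by (simp add: lessThan_nat_numeral fact_numeral power_divide)
  also have "\<dots> \<le> exp 0.5976919" unfolding exp by simp
  also have "\<dots> \<le> exp y" using y by simp
  finally have exp_y: "1.817917 \<le> exp y" .
  have "1 / 2 < 0.5976919 * 0.4858945 * 1.817917 * 2 / (1 + 1.1117975 :: real)" by simp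
  also have "\<dots> \<le> y * 0.4858945 * exp y * 2 / (1 + s)"
    using s y exp_y by (intro frac_le mult_mono mult_nonneg_nonneg) auto
  finally show ?thesis unfolding extremal_defect_eq s_def[symmetric] y_def[symmetric] .
qed

lemma extremal_radius:
  obtains r0 where "0.4858935 < r0" "r0 < 0.4858945" "extremal_defect r0 = 1 / 2"
proof -
  have "continuous_on UNIV crescent_primitive_real"
    using crescent_primitive_real_deriv by (intro DERIV_continuous_on)
  then have "continuous_on {0.4858935..0.4858945} crescent_primitive_real"
    by (rule continuous_on_subset) simp
  then have "continuous_on {0.4858935..0.4858945} extremal_defect"
    unfolding extremal_defect_def by (intro continuous_intros)
  then obtain r0 where "0.4858935 \<le> r0" "r0 \<le> 0.4858945" "extremal_defect r0 = 1 / 2"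
    using IVT'[of extremal_defect "0.4858935" "1 / 2" "0.4858945"]
      extremal_defect_lower extremal_defect_upper by auto
  moreover from this have "r0 \<noteq> 0.4858935" "r0 \<noteq> 0.4858945"
    using extremal_defect_lower extremal_defect_upper by force+
  ultimately show thesis by (intro that) auto
qed

section \<open>The radius and its sharpness\<close>

lemma class_S_Cr_defect_le:
  assumes f: "f \<in> class_S_Cr" and z: "norm z \<le> 3 / 5"
  shows "norm (z * deriv f z - f z) \<le> extremal_defect (norm z)"
proof -
  obtain \<omega> where \<omega>: "\<And>z. norm z < 1 \<Longrightarrow> norm (\<omega> z) \<le> norm z"
    and eq: "\<And>z. norm z < 1 \<Longrightarrow> z * deriv f z = crescent (\<omega> z) * f z"
    using class_S_Cr_obtains[OF f] by metis
  have "z * deriv f z - f z = (crescent (\<omega> z) - 1) * f z"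
    using eq[of z] z by (simp add: algebra_simps)
  then have "norm (z * deriv f z - f z) = norm (crescent (\<omega> z) - 1) * norm (f z)"
    by (simp add: norm_mult)
  also have "\<dots> \<le> extremal_defect (norm z)"
  proof -
    have "norm (crescent (\<omega> z) - 1) \<le> norm z + sqrt (1 + (norm z)\<^sup>2) - 1"
      using \<omega>[of z] z by (intro norm_crescent_minus_one_le) auto
    moreover from this have "0 \<le> norm z + sqrt (1 + (norm z)\<^sup>2) - 1"
      using norm_ge_zero order_trans by blast
    ultimately show ?thesis
      unfolding extremal_defect_def using norm_class_S_Cr_le[OF f z] by (intro mult_mono) auto
  qed
  finally show ?thesis .
qed

theorem theorem2p14:
  shows "(\<exists>c :: nat \<Rightarrow> complex.
            (\<forall>z \<in> ball 0 1. (\<lambda>n. c n * z ^ n) sums f0 z) \<and>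
            c 0 = 0 \<and> c 1 = 1 \<and> c 2 = 1 \<and> c 3 = 3 / 4 \<and> c 4 = 5 / 12 \<and> c 5 = 1 / 6) \<and>
         (\<exists>r0 :: real.
            0 < r0 \<and> radius_equation r0 \<and>
            (\<forall>r. 0 < r \<and> r < r0 \<longrightarrow> \<not> radius_equation r) \<and>
            \<bar>r0 - 0.485894\<bar> < 0.0000005 \<and>
            (\<forall>f \<in> class_S_Cr. f \<in> Omega_in_disc r0) \<and>
            (\<forall>\<rho> > r0. \<not> (\<forall>f \<in> class_S_Cr. f \<in> Omega_in_disc \<rho>)))"
proof (rule conjI[OF f0_power_series])
  obtain r0 where r0: "0.4858935 < r0" "r0 < 0.4858945" and eq: "extremal_defect r0 = 1 / 2"
    by (rule extremal_radius)
  \<comment> \<open>Strict monotonicity serves twice: no smaller positive root exists, and the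
    inequality is strict inside the disc.\<close>
  have below: "extremal_defect r < 1 / 2" if "0 \<le> r" "r < r0" for r
    using extremal_defect_strict_mono[OF that] eq by simp
  have "radius_equation r0" using r0 eq by (subst radius_equation_iff) auto
  moreover have "\<not> radius_equation r" if "0 < r" "r < r0" for r
    using below[of r] that r0 by (subst radius_equation_iff) auto
  moreover have "\<bar>r0 - 0.485894\<bar> < 0.0000005" using r0 unfolding abs_less_iff by simp
  moreover have "f \<in> Omega_in_disc r0" if f: "f \<in> class_S_Cr" for f
  proof -
    have "norm (z * deriv f z - f z) < 1 / 2" if "norm z < r0" for z
      using class_S_Cr_defect_le[OF f, of z] below[of "norm z"] that r0 by auto
    then show ?thesis using f by (auto simp: Omega_in_disc_def class_S_Cr_def)
  qed
  moreover have "f0 \<notin> Omega_in_disc \<rho>" if "r0 < \<rho>" for \<rho>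
  proof -
    \<comment> \<open>The point \<open>z = r0\<close> lies in every larger disc, and there
      \<open>f0\<close> attains exactly 1/2, violating the strict inequality.\<close>
    define z :: complex where "z = of_real r0"
    have z: "norm z < 1" "norm z < \<rho>" using r0 that by (auto simp: z_def)
    have "crescent z = of_real (r0 + sqrt (1 + r0\<^sup>2))"
      using csqrt_of_real_nonneg[of "1 + r0\<^sup>2"] by (simp add: crescent_def z_def)
    moreover have "f0 z = of_real (r0 * exp (crescent_primitive_real r0))"
      unfolding z_def using r0 by (intro f0_of_real) auto
    ultimately have "z * deriv f0 z - f0 z = of_real (extremal_defect r0)"
      unfolding deriv_f0_mult[OF z(1)] extremal_defect_def by (simp add: algebra_simps)
    then have "norm (z * deriv f0 z - f0 z) = 1 / 2" by (simp add: eq del: of_real_divide)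
    then show ?thesis using z by (auto simp: Omega_in_disc_def intro!: bexI[of _ z])
  qed
  ultimately show "\<exists>r0. 0 < r0 \<and> radius_equation r0 \<and>
      (\<forall>r. 0 < r \<and> r < r0 \<longrightarrow> \<not> radius_equation r) \<and>
      \<bar>r0 - 0.485894\<bar> < 0.0000005 \<and>
      (\<forall>f \<in> class_S_Cr. f \<in> Omega_in_disc r0) \<and>
      (\<forall>\<rho> > r0. \<not> (\<forall>f \<in> class_S_Cr. f \<in> Omega_in_disc \<rho>))"
    using r0 f0_in_class_S_Cr by (intro exI[of _ r0]) auto
qed

end
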